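(* Assume MA($\sigma$-centered). If $\mathcal{I}$ is a strongly unboring ideal, then there is an uncountable separable Mr\'owka space in $\mathrm{FinBW}(\mathcal{I})$.
   Context: An ideal on an infinite countable set $X$ is a family $\mathcal{I}\subseteq\mathcal{P}(X)$ closed under subsets and finite unions, containing all finite subsets, with $X\notin\mathcal{I}$. $\mathcal{I}|C=\{A\cap C:A\in\mathcal{I}\}$. A space $X$ is in $\mathrm{FinBW}(\mathcal{I})$ if $X$ is Hausdorff and for every sequence $(x_n)_{n\in\bigcup\mathcal{I}}$ in $X$ there is $A\notin\mathcal{I}$ with $(x_n)_{n\in A}$ convergent in $X$. $\mathcal{D}_{\mathcal{I}}$ is the set of functions $f:\bigcup\mathcal{I}\to\omega$ with $f^{-1}[\{n\}]\in\mathcal{I}$ for all $n$. An ideal $\mathcal{I}$ on $X$ is $\omega$-diagonalizable by $\mathcal{I}^\star$-universal sets if there are families $\mathcal{Z}_k\subseteq[X]^{<\omega}\setminus\{\emptyset\}$, $k\in\omega$, such that for each $k$ and each $A\in\mathcal{I}$ there is $Z\in\mathcal{Z}_k$ with $Z\cap A=\emptyset$, and for each $A\in\mathcal{I}$ there is $k$ such that no $Z\in\mathcal{Z}_k$ is contained in $A$. $\mathcal{I}$ is strongly unboring if for each $f\in\mathcal{D}_{\mathcal{I}}$ there is $C\notin\mathcal{I}$ such that $f|C$ is finite-to-one and $\mathcal{I}|C$ (an ideal on $C$) is $\omega$-diagonalizable by $(\mathcal{I}|C)^\star$-universal sets. A Mr\'owka space is $\Phi(\mathcal{A})$ for an infinite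 almost disjoint family $\mathcal{A}$ of infinite subsets of $\omega$: underlying set $\omega\cup\mathcal{A}\cup\{\infty\}$, points of $\omega$ isolated, basic neighbourhoods of $A\in\mathcal{A}$ are $\{A\}\cup(A\setminus F)$ ($F\subseteq\omega$ finite), of $\infty$ are $\{\infty\}\cup(\mathcal{A}\setminus G)\cup(\omega\setminus(F\cup\bigcup G))$ ($F\subseteq\omega$, $G\subseteq\mathcal{A}$ finite). *)

theory Defs
  imports "HOL-Analysis.Analysis"
begin

text \<open>A forcing notion: a nonempty set P with a preorder le (le p q: p is stronger than q).\<close>

definition forcing_poset :: "'p set \<Rightarrow> ('p \<Rightarrow> 'p \<Rightarrow> bool) \<Rightarrow> bool" where
  "forcing_poset P le \<longleftrightarrow> P \<noteq> {} \<and> (\<forall>p\<in>P. le p p) \<and>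
     (\<forall>p\<in>P. \<forall>q\<in>P. \<forall>r\<in>P. le p q \<longrightarrow> le q r \<longrightarrow> le p r)"

definition centered_in :: "'p set \<Rightarrow> ('p \<Rightarrow> 'p \<Rightarrow> bool) \<Rightarrow> 'p set \<Rightarrow> bool" where
  "centered_in P le C \<longleftrightarrow> C \<subseteq> P \<and>
     (\<forall>F. finite F \<and> F \<subseteq> C \<longrightarrow> (\<exists>r\<in>P. \<forall>q\<in>F. le r q))"

definition sigma_centered :: "'p set \<Rightarrow> ('p \<Rightarrow> 'p \<Rightarrow> bool) \<Rightarrow> bool" where
  "sigma_centered P le \<longleftrightarrow> (\<exists>C :: nat \<Rightarrow> 'p set. (\<forall>n. centered_in P le (C n)) \<and> P = (\<Union>n. C n))"

definition dense_in :: "'p set \<Rightarrow> ('p \<Rightarrow> 'p \<Rightarrow> bool) \<Rightarrow> 'p set \<Rightarrow> bool" where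
  "dense_in P le D \<longleftrightarrow> D \<subseteq> P \<and> (\<forall>p\<in>P. \<exists>d\<in>D. le d p)"

definition filter_in :: "'p set \<Rightarrow> ('p \<Rightarrow> 'p \<Rightarrow> bool) \<Rightarrow> 'p set \<Rightarrow> bool" where
  "filter_in P le G \<longleftrightarrow> G \<subseteq> P \<and> G \<noteq> {} \<and>
     (\<forall>p\<in>G. \<forall>q\<in>P. le p q \<longrightarrow> q \<in> G) \<and>
     (\<forall>p\<in>G. \<forall>q\<in>G. \<exists>r\<in>G. le r p \<and> le r q)"

text \<open>MA(sigma-centered): for every sigma-centered poset and every family of fewer than
  continuum many dense sets there is a filter meeting all of them. Posets are taken with
  carrier a subset of the type nat set (of size continuum); since the relevant posets
  may be assumed to have size at most continuum, this is the usual axiom.\<close>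

definition MA_sigma_centered :: bool where
  "MA_sigma_centered \<longleftrightarrow>
    (\<forall>(P :: nat set set) le. forcing_poset P le \<and> sigma_centered P le \<longrightarrow>
       (\<forall>\<D> :: nat set set set. (\<forall>D\<in>\<D>. dense_in P le D) \<and> (card_of \<D>, card_of (UNIV :: real set)) \<in> ordLess \<longrightarrow>
          (\<exists>G. filter_in P le G \<and> (\<forall>D\<in>\<D>. G \<inter> D \<noteq> {}))))"

definition is_ideal_on :: "'a set \<Rightarrow> 'a set set \<Rightarrow> bool" where
  "is_ideal_on X I \<longleftrightarrow> I \<subseteq> Pow X \<and>
     (\<forall>A\<in>I. \<forall>B. B \<subseteq> A \<longrightarrow> B \<in> I) \<and>
     (\<forall>A\<in>I. \<forall>B\<in>I. A \<union> B \<in> I) \<and>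
     (\<forall>F. finite F \<and> F \<subseteq> X \<longrightarrow> F \<in> I) \<and>
     X \<notin> I"

definition ideal_restr :: "'a set set \<Rightarrow> 'a set \<Rightarrow> 'a set set" where
  "ideal_restr I C = {A \<inter> C | A. A \<in> I}"

definition D_ideal :: "'a set set \<Rightarrow> ('a \<Rightarrow> nat) set" where
  "D_ideal I = {f. (\<forall>x. x \<notin> \<Union>I \<longrightarrow> f x = undefined) \<and>
                   (\<forall>n. {x \<in> \<Union>I. f x = n} \<in> I)}"

definition omega_diag_univ :: "'a set \<Rightarrow> 'a set set \<Rightarrow> bool" where
  "omega_diag_univ X J \<longleftrightarrow> (\<exists>\<Z> :: nat \<Rightarrow> 'a set set.
     (\<forall>k. \<Z> k \<subseteq> {Z. finite Z \<and> Z \<subseteq> X \<and> Z \<noteq> {}}) \<and>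
     (\<forall>k. \<forall>A\<in>J. \<exists>Z\<in>\<Z> k. Z \<inter> A = {}) \<and>
     (\<forall>A\<in>J. \<exists>k. \<forall>Z\<in>\<Z> k. \<not> Z \<subseteq> A))"

definition strongly_unboring :: "'a set set \<Rightarrow> bool" where
  "strongly_unboring I \<longleftrightarrow> (\<forall>f\<in>D_ideal I. \<exists>C. C \<subseteq> \<Union>I \<and> C \<notin> I \<and>
      (\<forall>n. finite {x \<in> C. f x = n}) \<and> omega_diag_univ C (ideal_restr I C))"

definition FinBW :: "'a set set \<Rightarrow> 'b topology \<Rightarrow> bool" where
  "FinBW I T \<longleftrightarrow> Hausdorff_space T \<and>
     (\<forall>x :: 'a \<Rightarrow> 'b. (\<forall>n\<in>\<Union>I. x n \<in> topspace T) \<longrightarrow>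
        (\<exists>A. A \<subseteq> \<Union>I \<and> A \<notin> I \<and> (\<exists>L\<in>topspace T.
           \<forall>U. openin T U \<and> L \<in> U \<longrightarrow> finite {n \<in> A. x n \<notin> U})))"

datatype mpoint = MNat nat | MSet "nat set" | MInf

definition almost_disjoint_family :: "nat set set \<Rightarrow> bool" where
  "almost_disjoint_family \<A> \<longleftrightarrow> infinite \<A> \<and> (\<forall>A\<in>\<A>. infinite A) \<and>
     (\<forall>A\<in>\<A>. \<forall>B\<in>\<A>. A \<noteq> B \<longrightarrow> finite (A \<inter> B))"

definition mrowka_basis :: "nat set set \<Rightarrow> mpoint set set" where
  "mrowka_basis \<A> =
     {{MNat n} | n. True}
   \<union> {insert (MSet A) (MNat ` (A - F)) | A F. A \<in> \<A> \<and> finite F}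
   \<union> {insert MInf (MSet ` (\<A> - G) \<union> MNat ` (UNIV - (F \<union> \<Union>G))) | F G.
        finite F \<and> finite G \<and> G \<subseteq> \<A>}"

definition Mrowka :: "nat set set \<Rightarrow> mpoint topology" where
  "Mrowka \<A> = topology_generated_by (mrowka_basis \<A>)"

end

theory Submission
  imports Defs
begin

text \<open>
  Partial finite-to-one functions \<open>m : X \<rightharpoonup> \<omega>\<close> whose domain is as in the definition of strong
  unboringness are enumerated in type continuum, and \<open>\<A>\<close> is built recursively, adding one set
  \<open>B\<close> per function.  If some earlier \<open>A\<close> has \<open>m\<inverse>[A] \<notin> I\<close>, then \<open>m\<close> already converges to the point
  \<open>A\<close> along a set outside \<open>I\<close>, and \<open>B\<close> is any infinite set almost disjoint from the earlier ones.
  Otherwise the fewer than continuum many sets \<open>m\<inverse>[A]\<close> lie in \<open>I\<close>, and MA for the Mathias-like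
  poset of pairs (finite approximation, promise to avoid a set of the ideal) yields
  \<open>D \<subseteq> dom m\<close> almost disjoint from all of them and containing a member of every \<open>\<Z>\<^sub>k\<close>,
  hence outside \<open>I\<close>; put \<open>B = m[D]\<close>.

  A sequence in the resulting space is constant on a set outside \<open>I\<close>, or else it is finite-to-one
  on a set \<open>C\<close> as in the definition of strong unboringness.  It then converges to \<open>\<infinity>\<close> on the part
  of \<open>C\<close> with values outside \<open>\<omega>\<close>; if that part lies in \<open>I\<close>, the values there may be replaced by
  arbitrary distinct natural numbers, which turns the sequence into one of the functions \<open>m\<close>.
\<close>

section \<open>Cardinalities below the continuum\<close>

lemma lesspoll_iff_not_lepoll: "A \<prec> B \<longleftrightarrow> \<not> B \<lesssim> A"
proof
  show "\<not> B \<lesssim> A" if "A \<prec> B" using that lepoll_antisym unfolding lesspoll_def by blast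
  assume not_le: "\<not> B \<lesssim> A"
  then have "(card_of A, card_of B) \<in> ordLess" unfolding lepoll_def card_of_ordLess .
  then have "A \<lesssim> B" unfolding lepoll_def card_of_ordLeq by (rule ordLess_imp_ordLeq)
  then show "A \<prec> B" using not_le eqpoll_sym eqpoll_imp_lepoll unfolding lesspoll_def by blast
qed

lemma lesspoll_iff_card_of_ordLess: "A \<prec> B \<longleftrightarrow> (card_of A, card_of B) \<in> ordLess"
  unfolding lesspoll_iff_not_lepoll lepoll_def card_of_ordLess ..

lemma Un_lesspoll_infinite:
  "infinite C \<Longrightarrow> A \<prec> C \<Longrightarrow> B \<prec> C \<Longrightarrow> A \<union> B \<prec> C"
  unfolding lesspoll_iff_card_of_ordLess by (rule card_of_Un_ordLess_infinite)

lemma image_lesspoll: "A \<prec> B \<Longrightarrow> f ` A \<prec> B"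
  by (rule lesspoll_trans1[OF image_lepoll])

lemma countable_lesspoll_uncountable: "countable A \<Longrightarrow> uncountable B \<Longrightarrow> A \<prec> B"
  unfolding lesspoll_iff_not_lepoll using countable_lepoll by blast

lemma underS_card_of_lesspoll: "underS (card_of (UNIV :: 'a set)) a \<prec> (UNIV :: 'a set)"
  unfolding lesspoll_iff_card_of_ordLess
  by (rule card_of_underS) (simp_all add: card_of_card_order_on Field_card_of)

lemma countable_Pow_lepoll_reals:
  assumes "countable X"
  shows "Pow X \<lesssim> (UNIV :: real set)"
proof -
  have "inj_on ((`) (to_nat_on X)) (Pow X)"
    using assms by (intro inj_on_image_Pow inj_on_to_nat_on)
  then have "Pow X \<lesssim> (UNIV :: nat set set)"
    unfolding lepoll_def by blast
  then show ?thesis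
    using nat_sets_eqpoll_reals by (rule lepoll_trans2)
qed

section \<open>Martin's axiom for posets of size at most continuum\<close>

definition push_order :: "('p \<Rightarrow> 'q) \<Rightarrow> 'p set \<Rightarrow> ('p \<Rightarrow> 'p \<Rightarrow> bool) \<Rightarrow> 'q \<Rightarrow> 'q \<Rightarrow> bool" where
  "push_order h P le x y \<longleftrightarrow> le (inv_into P h x) (inv_into P h y)"

context
  fixes h :: "'p \<Rightarrow> 'q" and P :: "'p set" and le :: "'p \<Rightarrow> 'p \<Rightarrow> bool"
  assumes inj: "inj_on h P"
begin

lemma push_order_iff: "p \<in> P \<Longrightarrow> q \<in> P \<Longrightarrow> push_order h P le (h p) (h q) \<longleftrightarrow> le p q"
  using inj by (simp add: push_order_def)

lemma forcing_poset_push_order_iff: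
  "forcing_poset (h ` P) (push_order h P le) \<longleftrightarrow> forcing_poset P le"
  unfolding forcing_poset_def by (simp add: push_order_iff cong: ball_cong)

lemma centered_in_push_order:
  assumes "centered_in P le C"
  shows "centered_in (h ` P) (push_order h P le) (h ` C)"
  unfolding centered_in_def
proof (intro conjI allI impI)
  show "h ` C \<subseteq> h ` P" using assms by (auto simp: centered_in_def)
  fix F assume "finite F \<and> F \<subseteq> h ` C"
  then obtain E where E: "E \<subseteq> C" "finite E" "F = h ` E" by (meson finite_subset_image)
  with assms obtain r where "r \<in> P" "\<forall>q\<in>E. le r q" unfolding centered_in_def by blast
  moreover have "E \<subseteq> P" using E(1) assms by (auto simp: centered_in_def)
  ultimately show "\<exists>r\<in>h ` P. \<forall>q\<in>F. push_order h P le r q"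
    unfolding E(3) by (auto simp: push_order_iff subset_iff)
qed

lemma sigma_centered_push_order:
  assumes "sigma_centered P le"
  shows "sigma_centered (h ` P) (push_order h P le)"
proof -
  obtain C :: "nat \<Rightarrow> 'p set" where "\<forall>n. centered_in P le (C n)" "P = (\<Union>n. C n)"
    using assms unfolding sigma_centered_def by blast
  then have "\<forall>n. centered_in (h ` P) (push_order h P le) (h ` C n)" "h ` P = (\<Union>n. h ` C n)"
    using centered_in_push_order by blast+
  then show ?thesis unfolding sigma_centered_def by (intro exI[of _ "\<lambda>n. h ` C n"] conjI)
qed

lemma dense_in_push_order:
  assumes "dense_in P le D"
  shows "dense_in (h ` P) (push_order h P le) (h ` D)"
  unfolding dense_in_def
proof (intro conjI ballI)
  have D: "D \<subseteq> P" using assms by (simp add: dense_in_def)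
  then show "h ` D \<subseteq> h ` P" by blast
  fix x assume "x \<in> h ` P"
  then obtain p where p: "p \<in> P" "x = h p" by blast
  then obtain d where d: "d \<in> D" "le d p" using assms unfolding dense_in_def by blast
  then have "push_order h P le (h d) x" using D p by (simp add: push_order_iff subset_iff)
  with d(1) show "\<exists>y\<in>h ` D. push_order h P le y x" by blast
qed

lemma filter_in_pull_back:
  assumes G: "filter_in (h ` P) (push_order h P le) G"
  shows "filter_in P le {p \<in> P. h p \<in> G}"
  unfolding filter_in_def
proof (intro conjI ballI impI)
  have G_P: "G \<subseteq> h ` P" "G \<noteq> {}" using G by (simp_all add: filter_in_def)
  then show "{p \<in> P. h p \<in> G} \<noteq> {}" by blast
  show "q \<in> {p \<in> P. h p \<in> G}" if "p \<in> {p \<in> P. h p \<in> G}" "q \<in> P" "le p q" for p q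
  proof -
    have "push_order h P le (h p) (h q)" using that by (simp add: push_order_iff)
    then show ?thesis using G that unfolding filter_in_def by blast
  qed
  fix p q assume pq: "p \<in> {p \<in> P. h p \<in> G}" "q \<in> {p \<in> P. h p \<in> G}"
  then obtain x where x: "x \<in> G" "push_order h P le x (h p)" "push_order h P le x (h q)"
    using G unfolding filter_in_def by blast
  then obtain r where "r \<in> P" "x = h r" using G_P(1) by blast
  with x pq have "r \<in> {p \<in> P. h p \<in> G}" "le r p" "le r q" by (simp_all add: push_order_iff)
  then show "\<exists>r\<in>{p \<in> P. h p \<in> G}. le r p \<and> le r q" by blast
qed simp

end

lemma MA_sigma_centered_generic_filter:
  fixes P :: "'p set"
  assumes MA: MA_sigma_centered
    and P: "P \<lesssim> (UNIV :: real set)" "forcing_poset P le" "sigma_centered P le"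
    and \<D>: "\<D> \<prec> (UNIV :: real set)" "\<forall>D\<in>\<D>. dense_in P le D"
  shows "\<exists>G. filter_in P le G \<and> (\<forall>D\<in>\<D>. G \<inter> D \<noteq> {})"
proof -
  have "P \<lesssim> (UNIV :: nat set set)"
    using P(1) eqpoll_sym[OF nat_sets_eqpoll_reals] by (rule lepoll_trans2)
  then obtain h :: "'p \<Rightarrow> nat set" where h: "inj_on h P"
    unfolding lepoll_def by blast
  define \<D>' where "\<D>' = (`) h ` \<D>"
  have "(card_of \<D>', card_of (UNIV :: real set)) \<in> ordLess"
    using image_lesspoll[OF \<D>(1)] unfolding \<D>'_def lesspoll_iff_card_of_ordLess .
  moreover have "\<forall>D\<in>\<D>'. dense_in (h ` P) (push_order h P le) D"
    using \<D>(2) dense_in_push_order[OF h] unfolding \<D>'_def by blast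
  ultimately obtain G where G: "filter_in (h ` P) (push_order h P le) G" "\<forall>D\<in>\<D>'. G \<inter> D \<noteq> {}"
    using MA P(2)[folded forcing_poset_push_order_iff[OF h]] sigma_centered_push_order[OF h P(3)]
    unfolding MA_sigma_centered_def by metis
  have "filter_in P le {p \<in> P. h p \<in> G}" using h G(1) by (rule filter_in_pull_back)
  moreover have "{p \<in> P. h p \<in> G} \<inter> D \<noteq> {}" if D: "D \<in> \<D>" for D
  proof -
    have "G \<inter> h ` D \<noteq> {}" using G(2) D unfolding \<D>'_def by blast
    moreover have "D \<subseteq> P" using \<D>(2) D by (simp add: dense_in_def)
    ultimately show ?thesis by blast
  qed
  ultimately show ?thesis by blast
qed

section \<open>Mathias-like forcing\<close>

locale mathias_forcing =
  fixes X :: "'a set" and \<U> :: "'a set set"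
  assumes countable_X: "countable X"
    and subset_X: "U \<in> \<U> \<Longrightarrow> U \<subseteq> X"
    and empty_mem: "{} \<in> \<U>"
    and Un_mem: "U \<in> \<U> \<Longrightarrow> V \<in> \<U> \<Longrightarrow> U \<union> V \<in> \<U>"
begin

definition conditions :: "('a set \<times> 'a set) set" where
  "conditions = Fpow X \<times> \<U>"

definition extends :: "'a set \<times> 'a set \<Rightarrow> 'a set \<times> 'a set \<Rightarrow> bool" where
  "extends p q \<longleftrightarrow> fst q \<subseteq> fst p \<and> snd q \<subseteq> snd p \<and> (fst p - fst q) \<inter> snd q = {}"

lemma Union_mem: "finite \<V> \<Longrightarrow> \<V> \<subseteq> \<U> \<Longrightarrow> \<Union>\<V> \<in> \<U>"
  by (induction \<V> rule: finite_induct) (auto simp: empty_mem Un_mem)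

lemma forcing_poset_conditions: "forcing_poset conditions extends"
  unfolding forcing_poset_def
proof (intro conjI)
  show "conditions \<noteq> {}" using empty_mem Fpow_not_empty by (auto simp: conditions_def)
qed (auto simp: extends_def)

lemma conditions_lepoll_reals: "conditions \<lesssim> (UNIV :: real set)"
proof -
  have "inj_on (\<lambda>(s, U). s <+> U) conditions"
    by (auto simp: inj_on_def Plus_def)
  moreover have "(\<lambda>(s, U). s <+> U) ` conditions \<subseteq> Pow (X <+> X)"
    using subset_X by (fastforce simp: conditions_def Fpow_def)
  ultimately have "conditions \<lesssim> Pow (X <+> X)"
    unfolding lepoll_def by blast
  also have "Pow (X <+> X) \<lesssim> (UNIV :: real set)"
    using countable_X by (intro countable_Pow_lepoll_reals countable_Plus)
  finally show ?thesis .
qed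

lemma centered_in_common_stem:
  assumes "s \<in> Fpow X"
  shows "centered_in conditions extends ({s} \<times> \<U>)"
  unfolding centered_in_def
proof (intro conjI allI impI)
  show "{s} \<times> \<U> \<subseteq> conditions" using assms by (auto simp: conditions_def)
  fix F assume F: "finite F \<and> F \<subseteq> {s} \<times> \<U>"
  then have "\<Union>(snd ` F) \<in> \<U>" by (intro Union_mem) auto
  then have "(s, \<Union>(snd ` F)) \<in> conditions" using assms by (simp add: conditions_def)
  moreover have "\<forall>q\<in>F. extends (s, \<Union>(snd ` F)) q" using F by (auto simp: extends_def)
  ultimately show "\<exists>r\<in>conditions. \<forall>q\<in>F. extends r q" by blast
qed

lemma sigma_centered_conditions: "sigma_centered conditions extends"
proof -
  have "range (from_nat_into (Fpow X)) = Fpow X"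
    using countable_X by (intro range_from_nat_into Fpow_not_empty countable_Fpow)
  then have "conditions = (\<Union>n. {from_nat_into (Fpow X) n} \<times> \<U>)"
    unfolding conditions_def by blast
  moreover have "centered_in conditions extends ({from_nat_into (Fpow X) n} \<times> \<U>)" for n
    by (intro centered_in_common_stem from_nat_into Fpow_not_empty)
  ultimately show ?thesis
    unfolding sigma_centered_def by (intro exI[of _ "\<lambda>n. {from_nat_into (Fpow X) n} \<times> \<U>"]) simp
qed

lemma dense_in_promise:
  assumes "A \<in> \<U>"
  shows "dense_in conditions extends {p \<in> conditions. A \<subseteq> snd p}"
  unfolding dense_in_def
proof (intro conjI ballI)
  fix p assume "p \<in> conditions"
  then have "(fst p, snd p \<union> A) \<in> conditions" using Un_mem assms by (auto simp: conditions_def)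
  then show "\<exists>d\<in>{p \<in> conditions. A \<subseteq> snd p}. extends d p"
    by (intro bexI[of _ "(fst p, snd p \<union> A)"]) (auto simp: extends_def)
qed simp

lemma dense_in_stem:
  assumes "\<And>U. U \<in> \<U> \<Longrightarrow> \<exists>Z\<in>\<Z>. Z \<in> Fpow X \<and> Z \<inter> U = {}"
  shows "dense_in conditions extends {p \<in> conditions. \<exists>Z\<in>\<Z>. Z \<subseteq> fst p}"
  unfolding dense_in_def
proof (intro conjI ballI)
  fix p assume p: "p \<in> conditions"
  then obtain Z where Z: "Z \<in> \<Z>" "Z \<in> Fpow X" "Z \<inter> snd p = {}"
    using assms[of "snd p"] by (auto simp: conditions_def)
  then have "(fst p \<union> Z, snd p) \<in> conditions" using p by (auto simp: conditions_def Fpow_def)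
  then show "\<exists>d\<in>{p \<in> conditions. \<exists>Z\<in>\<Z>. Z \<subseteq> fst p}. extends d p"
    using Z by (intro bexI[of _ "(fst p \<union> Z, snd p)"]) (auto simp: extends_def)
qed simp

lemma finite_generic_set_Int:
  assumes G: "filter_in conditions extends G" and p: "p \<in> G" "A \<subseteq> snd p"
  shows "finite (\<Union>(fst ` G) \<inter> A)"
proof (rule finite_subset)
  show "finite (fst p)" using G p(1) by (auto simp: filter_in_def conditions_def Fpow_def)
  show "\<Union>(fst ` G) \<inter> A \<subseteq> fst p"
  proof
    fix x assume "x \<in> \<Union>(fst ` G) \<inter> A"
    then obtain q where "q \<in> G" "x \<in> fst q" "x \<in> A" by blast
    moreover from \<open>q \<in> G\<close> obtain r where "extends r p" "extends r q"
      using G p(1) unfolding filter_in_def by blast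
    ultimately show "x \<in> fst p" using p(2) unfolding extends_def by blast
  qed
qed

lemma MA_generic_set:
  assumes MA: MA_sigma_centered
    and F: "F \<subseteq> \<U>" "F \<prec> (UNIV :: real set)"
    and Z: "\<And>U k. U \<in> \<U> \<Longrightarrow> \<exists>Z\<in>\<Z> k. Z \<in> Fpow X \<and> Z \<inter> U = {}"
  shows "\<exists>D\<subseteq>X. (\<forall>A\<in>F. finite (D \<inter> A)) \<and> (\<forall>k :: nat. \<exists>Z\<in>\<Z> k. Z \<subseteq> D)"
proof -
  define promise where "promise A = {p \<in> conditions. A \<subseteq> snd p}" for A
  define stem where "stem k = {p \<in> conditions. \<exists>Z\<in>\<Z> k. Z \<subseteq> fst p}" for k
  have "promise ` F \<union> range stem \<prec> (UNIV :: real set)"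
    by (intro Un_lesspoll_infinite image_lesspoll F(2) countable_lesspoll_uncountable)
      (simp_all add: infinite_UNIV_char_0 uncountable_UNIV_real)
  moreover have "\<forall>E\<in>promise ` F \<union> range stem. dense_in conditions extends E"
    using F(1) dense_in_promise dense_in_stem[OF Z] unfolding promise_def stem_def by blast
  ultimately have "\<exists>G. filter_in conditions extends G \<and> (\<forall>E\<in>promise ` F \<union> range stem. G \<inter> E \<noteq> {})"
    by (rule MA_sigma_centered_generic_filter[OF MA conditions_lepoll_reals
          forcing_poset_conditions sigma_centered_conditions])
  then obtain G where G: "filter_in conditions extends G"
    and "\<forall>E\<in>promise ` F \<union> range stem. G \<inter> E \<noteq> {}"
    by (elim exE conjE)
  then have meets: "\<forall>A\<in>F. G \<inter> promise A \<noteq> {}" "\<forall>k. G \<inter> stem k \<noteq> {}"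
    by (simp_all add: ball_Un)
  show ?thesis
  proof (intro exI[of _ "\<Union>(fst ` G)"] conjI ballI allI)
    have "G \<subseteq> conditions" using G by (simp add: filter_in_def)
    then show "\<Union>(fst ` G) \<subseteq> X" unfolding conditions_def Fpow_def by fastforce
    show "finite (\<Union>(fst ` G) \<inter> A)" if "A \<in> F" for A
    proof -
      obtain p where "p \<in> G" "A \<subseteq> snd p" using meets(1) \<open>A \<in> F\<close> unfolding promise_def by blast
      with G show ?thesis by (rule finite_generic_set_Int)
    qed
    fix k
    obtain p where "p \<in> G" "\<exists>Z\<in>\<Z> k. Z \<subseteq> fst p" using meets(2) unfolding stem_def by blast
    then show "\<exists>Z\<in>\<Z> k. Z \<subseteq> \<Union>(fst ` G)" by blast
  qed
qed

end

lemma MA_almost_disjoint_set: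
  fixes X :: "'a set" and \<Z> :: "nat \<Rightarrow> 'a set set"
  assumes MA: MA_sigma_centered and X: "countable X"
    and F: "F \<subseteq> Pow X" "F \<prec> (UNIV :: real set)"
    and Z: "\<And>H k. finite H \<Longrightarrow> H \<subseteq> F \<Longrightarrow> \<exists>Z\<in>\<Z> k. Z \<in> Fpow X \<and> Z \<inter> \<Union>H = {}"
  shows "\<exists>D\<subseteq>X. (\<forall>A\<in>F. finite (D \<inter> A)) \<and> (\<forall>k. \<exists>Z\<in>\<Z> k. Z \<subseteq> D)"
proof -
  interpret mathias_forcing X "Union ` Fpow F"
  proof
    show "U \<union> V \<in> Union ` Fpow F" if UV: "U \<in> Union ` Fpow F" "V \<in> Union ` Fpow F" for U V
    proof -
      obtain H K where "H \<in> Fpow F" "U = \<Union>H" "K \<in> Fpow F" "V = \<Union>K" using UV by blast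
      then show ?thesis by (intro image_eqI[of _ _ "H \<union> K"]) (auto simp: Fpow_def)
    qed
    show "{} \<in> Union ` Fpow F" using empty_in_Fpow by (intro image_eqI[of _ _ "{}"]) auto
  qed (use X F(1) in \<open>auto simp: Fpow_def\<close>)
  have "F \<subseteq> Union ` Fpow F"
  proof
    fix A assume "A \<in> F"
    then show "A \<in> Union ` Fpow F" by (intro image_eqI[of _ _ "{A}"]) (auto simp: Fpow_def)
  qed
  moreover have "\<exists>Z\<in>\<Z> k. Z \<in> Fpow X \<and> Z \<inter> U = {}" if "U \<in> Union ` Fpow F" for U k
    using that Z by (auto simp: Fpow_def)
  ultimately show ?thesis by (rule MA_generic_set[OF MA _ F(2)])
qed

section \<open>Ideals\<close>

lemma is_ideal_on_subset: "is_ideal_on X I \<Longrightarrow> A \<in> I \<Longrightarrow> B \<subseteq> A \<Longrightarrow> B \<in> I"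
  unfolding is_ideal_on_def by blast

lemma is_ideal_on_Un: "is_ideal_on X I \<Longrightarrow> A \<in> I \<Longrightarrow> B \<in> I \<Longrightarrow> A \<union> B \<in> I"
  unfolding is_ideal_on_def by blast

lemma is_ideal_on_finite: "is_ideal_on X I \<Longrightarrow> finite A \<Longrightarrow> A \<subseteq> X \<Longrightarrow> A \<in> I"
  unfolding is_ideal_on_def by blast

lemma is_ideal_on_Diff_notin:
  assumes I: "is_ideal_on X I" and "A \<notin> I" "B \<in> I"
  shows "A - B \<notin> I"
proof
  assume "A - B \<in> I"
  then have "(A - B) \<union> B \<in> I" using I \<open>B \<in> I\<close> by (intro is_ideal_on_Un)
  then have "A \<in> I" by (rule is_ideal_on_subset[OF I]) blast
  with \<open>A \<notin> I\<close> show False by simp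
qed

lemma is_ideal_on_Union_finite:
  assumes I: "is_ideal_on X I" and "finite H" "H \<subseteq> I"
  shows "\<Union>H \<in> I"
  using assms(2,3)
  by (induction H rule: finite_induct) (auto intro: is_ideal_on_Un[OF I] is_ideal_on_finite[OF I])

lemma Union_is_ideal_on:
  assumes I: "is_ideal_on X I"
  shows "\<Union>I = X"
proof
  show "\<Union>I \<subseteq> X" using I by (auto simp: is_ideal_on_def)
  show "X \<subseteq> \<Union>I" using is_ideal_on_finite[OF I, of "{x}" for x] by blast
qed

lemma mem_ideal_restr_iff:
  assumes "is_ideal_on X I"
  shows "A \<in> ideal_restr I C \<longleftrightarrow> A \<in> I \<and> A \<subseteq> C"
proof
  assume "A \<in> I \<and> A \<subseteq> C"
  then show "A \<in> ideal_restr I C" unfolding ideal_restr_def by blast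
qed (auto simp: ideal_restr_def intro: is_ideal_on_subset[OF assms])

lemma is_ideal_on_restr:
  assumes I: "is_ideal_on X I" and C: "C \<subseteq> X" "C \<notin> I"
  shows "is_ideal_on C (ideal_restr I C)"
  unfolding is_ideal_on_def[of C] mem_ideal_restr_iff[OF I]
proof (intro conjI ballI allI impI)
  show "ideal_restr I C \<subseteq> Pow C" by (auto simp: ideal_restr_def)
  show "\<not> (C \<in> I \<and> C \<subseteq> C)" using C(2) by simp
  fix A assume A: "A \<in> ideal_restr I C"
  show "B \<in> I" "B \<subseteq> C" if "B \<subseteq> A" for B
    using A that is_ideal_on_subset[OF I] by (auto simp: mem_ideal_restr_iff[OF I])
  show "A \<union> B \<in> I" "A \<union> B \<subseteq> C" if "B \<in> ideal_restr I C" for B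
    using A that is_ideal_on_Un[OF I] by (auto simp: mem_ideal_restr_iff[OF I])
next
  show "F \<in> I" "F \<subseteq> C" if "finite F \<and> F \<subseteq> C" for F
    using that C(1) is_ideal_on_finite[OF I] by auto
qed

lemma MA_omega_diag_almost_disjoint_set:
  fixes C :: "'a set"
  assumes MA: MA_sigma_centered and C: "countable C"
    and J: "is_ideal_on C J" and diag: "omega_diag_univ C J"
    and F: "F \<subseteq> J" "F \<prec> (UNIV :: real set)"
  shows "\<exists>D\<subseteq>C. D \<notin> J \<and> (\<forall>A\<in>F. finite (D \<inter> A))"
proof -
  obtain \<Z> :: "nat \<Rightarrow> 'a set set" where fin: "\<forall>k. \<Z> k \<subseteq> {Z. finite Z \<and> Z \<subseteq> C \<and> Z \<noteq> {}}"
    and avoid: "\<forall>k. \<forall>A\<in>J. \<exists>Z\<in>\<Z> k. Z \<inter> A = {}"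
    and not_inside: "\<forall>A\<in>J. \<exists>k. \<forall>Z\<in>\<Z> k. \<not> Z \<subseteq> A"
    using diag unfolding omega_diag_univ_def by (elim exE conjE)
  have "F \<subseteq> Pow C" using F(1) J by (auto simp: is_ideal_on_def)
  moreover have "\<exists>Z\<in>\<Z> k. Z \<in> Fpow C \<and> Z \<inter> \<Union>H = {}" if "finite H" "H \<subseteq> F" for H k
  proof -
    have "\<Union>H \<in> J" using that F(1) by (intro is_ideal_on_Union_finite[OF J]) auto
    then obtain Z where Z: "Z \<in> \<Z> k" "Z \<inter> \<Union>H = {}" using avoid[rule_format] by meson
    then have "Z \<in> Fpow C" using fin[rule_format, of k] by (auto simp: Fpow_def)
    with Z show ?thesis by (intro bexI[of _ Z] conjI)
  qed
  ultimately have "\<exists>D\<subseteq>C. (\<forall>A\<in>F. finite (D \<inter> A)) \<and> (\<forall>k. \<exists>Z\<in>\<Z> k. Z \<subseteq> D)"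
    by (rule MA_almost_disjoint_set[OF MA C _ F(2)])
  then obtain D where D: "D \<subseteq> C" "\<forall>A\<in>F. finite (D \<inter> A)" "\<forall>k. \<exists>Z\<in>\<Z> k. Z \<subseteq> D"
    by (elim exE conjE)
  have "D \<notin> J"
  proof
    assume "D \<in> J"
    then obtain k where "\<forall>Z\<in>\<Z> k. \<not> Z \<subseteq> D" using not_inside[rule_format] by meson
    moreover obtain Z where "Z \<in> \<Z> k" "Z \<subseteq> D" using D(3) by meson
    ultimately show False by simp
  qed
  with D(1,2) show ?thesis by (intro exI[of _ D] conjI)
qed

section \<open>Almost disjoint families\<close>

definition almost_disjoint_from :: "nat set set \<Rightarrow> nat set \<Rightarrow> bool" where
  "almost_disjoint_from \<A> B \<longleftrightarrow> infinite B \<and> (\<forall>A\<in>\<A>. finite (A \<inter> B))"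

lemma almost_disjoint_family_finite_Int_Union:
  assumes \<A>: "almost_disjoint_family \<A>" and A: "A \<in> \<A>"
    and H: "finite H" "H \<subseteq> \<A>" "A \<notin> H"
  shows "finite (A \<inter> \<Union>H)"
proof -
  have "finite (A \<inter> B)" if "B \<in> H" for B
  proof -
    have "B \<in> \<A>" "A \<noteq> B" using that H by auto
    then show ?thesis using \<A> A by (simp add: almost_disjoint_family_def)
  qed
  with H(1) show ?thesis unfolding Int_Union by (intro finite_UN_I)
qed

lemma almost_disjoint_family_prod_encode_columns:
  "almost_disjoint_family (range (\<lambda>n. range (\<lambda>k. prod_encode (n, k))))"
    (is "almost_disjoint_family (range ?column)")
proof -
  have disjoint: "?column m \<inter> ?column n = {}" if "m \<noteq> n" for m n
    using that by auto
  have infinite_column: "infinite (?column n)" for n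
    by (rule range_inj_infinite) (auto simp: inj_on_def)
  have "inj ?column"
    using disjoint by (intro injI) (metis Int_absorb UNIV_not_empty image_is_empty)
  then have "infinite (range ?column)" by (rule range_inj_infinite)
  moreover have "finite (A \<inter> B)" if "A \<in> range ?column" "B \<in> range ?column" "A \<noteq> B" for A B
    using that disjoint by (metis (no_types, lifting) finite.emptyI imageE)
  ultimately show ?thesis
    using infinite_column unfolding almost_disjoint_family_def by blast
qed

lemma MA_ex_almost_disjoint_from:
  assumes MA: MA_sigma_centered
    and \<A>: "almost_disjoint_family \<A>" "\<A> \<prec> (UNIV :: real set)"
  shows "\<exists>B. almost_disjoint_from \<A> B"
proof -
  have avoid: "\<exists>Z\<in>{{n} |n. k \<le> n}. Z \<in> Fpow UNIV \<and> Z \<inter> \<Union>H = {}"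
    if H: "finite H" "H \<subseteq> \<A>" for H and k :: nat
  proof -
    have "infinite (\<A> - H)" using H(1) \<A>(1) by (simp add: almost_disjoint_family_def)
    then obtain A where A: "A \<in> \<A>" "A \<notin> H" using infinite_imp_nonempty by blast
    then have "infinite (A - A \<inter> \<Union>H)"
      using \<A>(1) almost_disjoint_family_finite_Int_Union[OF \<A>(1) A(1) H A(2)]
      by (simp add: almost_disjoint_family_def)
    then obtain n where "k \<le> n" "n \<in> A - A \<inter> \<Union>H"
      unfolding infinite_nat_iff_unbounded_le by blast
    then show ?thesis by (intro bexI[of _ "{n}"]) (auto simp: Fpow_def)
  qed
  have "\<exists>D\<subseteq>UNIV. (\<forall>A\<in>\<A>. finite (D \<inter> A)) \<and> (\<forall>k. \<exists>Z\<in>{{n} |n. k \<le> n}. Z \<subseteq> D)"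
    by (rule MA_almost_disjoint_set[OF MA _ _ \<A>(2) avoid]) simp_all
  then obtain D where D: "\<forall>A\<in>\<A>. finite (D \<inter> A)" "\<forall>k. \<exists>Z\<in>{{n} |n. k \<le> n}. Z \<subseteq> D"
    by (elim exE conjE)
  have "\<exists>n\<ge>k. n \<in> D" for k using D(2)[rule_format, of k] by auto
  then have "infinite D" unfolding infinite_nat_iff_unbounded_le by blast
  with D(1) have "almost_disjoint_from \<A> D" by (simp add: almost_disjoint_from_def Int_commute)
  then show ?thesis ..
qed

context
  fixes r :: "'i rel" and \<B> :: "nat set set" and f :: "'i \<Rightarrow> nat set" and K :: "'i set"
  assumes total: "total_on UNIV r"
    and step: "\<And>i. i \<in> K \<Longrightarrow> almost_disjoint_from (\<B> \<union> f ` underS r i) (f i)"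
begin

lemma finite_Int_of_earlier:
  assumes "i \<in> K" "j \<in> K" "i \<noteq> j"
  shows "finite (f i \<inter> f j)"
proof -
  have earlier: "finite (f a \<inter> f b)" if "b \<in> K" "a \<in> underS r b" for a b
    using step[OF that(1)] that(2) by (simp add: almost_disjoint_from_def)
  have "i \<in> underS r j \<or> j \<in> underS r i"
    using total assms(3) by (auto simp: total_on_def underS_def)
  then show ?thesis using earlier assms(1,2) by (metis Int_commute)
qed

lemma inj_on_almost_disjoint_from_earlier: "inj_on f K"
proof (rule inj_onI, rule ccontr)
  fix i j assume ij: "i \<in> K" "j \<in> K" "f i = f j" "i \<noteq> j"
  then have "finite (f i)" using finite_Int_of_earlier[of i j] by simp
  with step[OF ij(1)] show False by (simp add: almost_disjoint_from_def)
qed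

lemma almost_disjoint_family_Un_image:
  assumes \<B>: "almost_disjoint_family \<B>"
  shows "almost_disjoint_family (\<B> \<union> f ` K)"
  unfolding almost_disjoint_family_def
proof (intro conjI ballI impI)
  show "infinite (\<B> \<union> f ` K)" using \<B> by (simp add: almost_disjoint_family_def)
  show "infinite A" if "A \<in> \<B> \<union> f ` K" for A
    using that \<B> step by (auto simp: almost_disjoint_family_def almost_disjoint_from_def)
  have base: "finite (A \<inter> f i)" if "A \<in> \<B>" "i \<in> K" for A i
    using step[OF that(2)] that(1) by (simp add: almost_disjoint_from_def)
  fix A B assume "A \<in> \<B> \<union> f ` K" "B \<in> \<B> \<union> f ` K" "A \<noteq> B"
  then show "finite (A \<inter> B)"
    using \<B> base finite_Int_of_earlier by (auto simp: almost_disjoint_family_def Int_commute)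
qed

end

lemma almost_disjoint_wf_choice:
  fixes r :: "'i rel" and Q :: "'i \<Rightarrow> nat set set \<Rightarrow> bool"
  assumes r: "wf (r - Id)" "total_on UNIV r" and \<B>: "almost_disjoint_family \<B>"
    and extend: "\<And>i f. almost_disjoint_family (\<B> \<union> f ` underS r i) \<Longrightarrow>
      \<exists>B. almost_disjoint_from (\<B> \<union> f ` underS r i) B \<and> Q i (insert B (\<B> \<union> f ` underS r i))"
  shows "\<exists>f. \<forall>i. almost_disjoint_from (\<B> \<union> f ` underS r i) (f i) \<and>
    Q i (insert (f i) (\<B> \<union> f ` underS r i))"
proof (rule dependent_wf_choice[OF r(1)])
  have underS: "j \<in> underS r i \<longleftrightarrow> (j, i) \<in> r - Id" for i j
    by (auto simp: underS_def)
  fix f g :: "'i \<Rightarrow> nat set" and i B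
  show "(almost_disjoint_from (\<B> \<union> f ` underS r i) B \<and> Q i (insert B (\<B> \<union> f ` underS r i))) =
      (almost_disjoint_from (\<B> \<union> g ` underS r i) B \<and> Q i (insert B (\<B> \<union> g ` underS r i)))"
    if "\<And>j. (j, i) \<in> r - Id \<Longrightarrow> f j = g j"
  proof -
    have "f ` underS r i = g ` underS r i" using that by (intro image_cong) (simp_all add: underS)
    then show ?thesis by simp
  qed
  assume IH: "\<And>j. (j, i) \<in> r - Id \<Longrightarrow> almost_disjoint_from (\<B> \<union> f ` underS r j) (f j) \<and>
    Q j (insert (f j) (\<B> \<union> f ` underS r j))"
  have "almost_disjoint_family (\<B> \<union> f ` underS r i)"
    using r(2) _ \<B> by (rule almost_disjoint_family_Un_image) (use IH underS in blast)
  then show "\<exists>B. almost_disjoint_from (\<B> \<union> f ` underS r i) B \<and>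
      Q i (insert B (\<B> \<union> f ` underS r i))"
    by (rule extend)
qed

lemma almost_disjoint_family_by_recursion:
  fixes Q :: "real \<Rightarrow> nat set set \<Rightarrow> bool"
  assumes extend: "\<And>i \<A>. almost_disjoint_family \<A> \<Longrightarrow> \<A> \<prec> (UNIV :: real set) \<Longrightarrow>
      \<exists>B. almost_disjoint_from \<A> B \<and> Q i (insert B \<A>)"
    and mono: "\<And>i \<A> \<B>. Q i \<A> \<Longrightarrow> \<A> \<subseteq> \<B> \<Longrightarrow> Q i \<B>"
  shows "\<exists>\<A>. almost_disjoint_family \<A> \<and> uncountable \<A> \<and> (\<forall>i. Q i \<A>)"
proof -
  define r where "r = card_of (UNIV :: real set)"
  have "Well_order r" "Field r = UNIV"
    unfolding r_def using card_of_Well_order by (simp_all add: Field_card_of)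
  then have wf: "wf (r - Id)" and total: "total_on UNIV r"
    unfolding well_order_on_def linear_order_on_def by simp_all
  obtain \<B> where \<B>: "almost_disjoint_family \<B>" "countable \<B>"
    using almost_disjoint_family_prod_encode_columns by (metis countable_image countableI_type)
  have small: "\<B> \<union> f ` underS r i \<prec> (UNIV :: real set)" for f i
    unfolding r_def
    by (intro Un_lesspoll_infinite image_lesspoll underS_card_of_lesspoll
        countable_lesspoll_uncountable \<B>(2) uncountable_UNIV_real infinite_UNIV_char_0)
  have "\<exists>f. \<forall>i. almost_disjoint_from (\<B> \<union> f ` underS r i) (f i) \<and>
      Q i (insert (f i) (\<B> \<union> f ` underS r i))"
    using wf total \<B>(1) by (rule almost_disjoint_wf_choice) (rule extend[OF _ small])
  then obtain f where step: "\<And>i. almost_disjoint_from (\<B> \<union> f ` underS r i) (f i)"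
    and Q: "\<And>i. Q i (insert (f i) (\<B> \<union> f ` underS r i))"
    by blast
  have "inj f" using total step by (rule inj_on_almost_disjoint_from_earlier)
  then have "uncountable (\<B> \<union> range f)"
    using uncountable_UNIV_real countable_image_inj_on[of f UNIV] by auto
  moreover have "almost_disjoint_family (\<B> \<union> range f)"
    using total step \<B>(1) by (rule almost_disjoint_family_Un_image)
  moreover have "Q i (\<B> \<union> range f)" for i by (rule mono[OF Q[of i]]) auto
  ultimately show ?thesis by blast
qed

section \<open>Capturing all witnesses of strong unboringness\<close>

definition unboring_witness :: "'a set set \<Rightarrow> ('a \<rightharpoonup> nat) \<Rightarrow> bool" where
  "unboring_witness I m \<longleftrightarrow> dom m \<subseteq> \<Union>I \<and> dom m \<notin> I \<and> (\<forall>n. finite (m -` {Some n})) \<and>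
     omega_diag_univ (dom m) (ideal_restr I (dom m))"

definition captures :: "'a set set \<Rightarrow> ('a \<rightharpoonup> nat) \<Rightarrow> nat set set \<Rightarrow> bool" where
  "captures I m \<A> \<longleftrightarrow> (\<exists>A\<in>\<A>. m -` Some ` A \<notin> I)"

lemma captures_mono: "captures I m \<A> \<Longrightarrow> \<A> \<subseteq> \<B> \<Longrightarrow> captures I m \<B>"
  by (auto simp: captures_def)

lemma MA_capture_by_almost_disjoint:
  fixes I :: "'a set set"
  assumes MA: MA_sigma_centered
    and \<A>: "\<A> \<prec> (UNIV :: real set)" "\<not> captures I m \<A>"
    and X: "countable X" and I: "is_ideal_on X I" and m: "unboring_witness I m"
  shows "\<exists>B. almost_disjoint_from \<A> B \<and> captures I m {B}"
proof -
  have dom: "dom m \<subseteq> X" "dom m \<notin> I" and fin: "\<And>n. finite (m -` {Some n})"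
    and diag: "omega_diag_univ (dom m) (ideal_restr I (dom m))"
    using m unfolding unboring_witness_def Union_is_ideal_on[OF I] by blast+
  define F where "F = (\<lambda>A. m -` Some ` A) ` \<A>"
  have "F \<subseteq> ideal_restr I (dom m)"
    using \<A>(2) by (auto simp: F_def captures_def mem_ideal_restr_iff[OF I])
  moreover have "F \<prec> (UNIV :: real set)" unfolding F_def using \<A>(1) by (rule image_lesspoll)
  ultimately obtain D where D: "D \<subseteq> dom m" "D \<notin> ideal_restr I (dom m)"
    "\<And>E. E \<in> F \<Longrightarrow> finite (D \<inter> E)"
    using MA_omega_diag_almost_disjoint_set[OF MA countable_subset[OF dom(1) X]
        is_ideal_on_restr[OF I dom] diag, of F] by blast
  then have "D \<notin> I" by (simp add: mem_ideal_restr_iff[OF I])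
  define B where "B = Some -` m ` D"
  have D_subset: "D \<subseteq> m -` Some ` B" using D(1) by (auto simp: B_def)
  have "infinite B"
  proof
    assume "finite B"
    then have "finite (\<Union>n\<in>B. m -` {Some n})" using fin by (intro finite_UN_I)
    then have "finite D" by (rule rev_finite_subset) (use D_subset in auto)
    then have "D \<in> I" using D(1) dom(1) by (intro is_ideal_on_finite[OF I]) auto
    with \<open>D \<notin> I\<close> show False by simp
  qed
  moreover have "finite (A \<inter> B)" if "A \<in> \<A>" for A
  proof (rule finite_subset)
    show "finite ((the \<circ> m) ` (D \<inter> m -` Some ` A))"
      using that by (intro finite_imageI D(3)) (simp add: F_def)
    show "A \<inter> B \<subseteq> (the \<circ> m) ` (D \<inter> m -` Some ` A)"
    proof
      fix n assume "n \<in> A \<inter> B"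
      then obtain x where "x \<in> D" "m x = Some n" "n \<in> A" by (auto simp: B_def)
      then show "n \<in> (the \<circ> m) ` (D \<inter> m -` Some ` A)" by (intro image_eqI[of _ _ x]) auto
    qed
  qed
  moreover have "m -` Some ` B \<notin> I" using \<open>D \<notin> I\<close> D_subset is_ideal_on_subset[OF I] by metis
  ultimately show ?thesis by (intro exI[of _ B]) (simp add: almost_disjoint_from_def captures_def)
qed

lemma MA_extend_almost_disjoint_family:
  assumes MA: MA_sigma_centered
    and \<A>: "almost_disjoint_family \<A>" "\<A> \<prec> (UNIV :: real set)"
    and X: "countable X" and I: "is_ideal_on X I"
  shows "\<exists>B. almost_disjoint_from \<A> B \<and> (unboring_witness I m \<longrightarrow> captures I m (insert B \<A>))"
proof (cases "unboring_witness I m \<and> \<not> captures I m \<A>")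
  case True
  then show ?thesis
    using MA_capture_by_almost_disjoint[OF MA \<A>(2) _ X I] captures_mono by blast
next
  case False
  then show ?thesis
    using MA_ex_almost_disjoint_from[OF MA \<A>] captures_mono by blast
qed

lemma partial_maps_to_nat_lepoll_reals:
  assumes "countable X"
  shows "{m :: 'a \<rightharpoonup> nat. dom m \<subseteq> X} \<lesssim> (UNIV :: real set)"
proof -
  have "inj Map.graph"
    by (auto simp: inj_def Map.graph_def fun_eq_iff set_eq_iff) (metis not_Some_eq)
  moreover have "Map.graph ` {m :: 'a \<rightharpoonup> nat. dom m \<subseteq> X} \<subseteq> Pow (X \<times> UNIV)"
    by (auto simp: Map.graph_def)
  ultimately have "{m :: 'a \<rightharpoonup> nat. dom m \<subseteq> X} \<lesssim> Pow (X \<times> (UNIV :: nat set))"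
    unfolding lepoll_def by (meson inj_on_subset subset_UNIV)
  also have "\<dots> \<lesssim> (UNIV :: real set)"
    using assms by (intro countable_Pow_lepoll_reals countable_SIGMA) auto
  finally show ?thesis .
qed

lemma MA_uncountable_family_capturing_witnesses:
  fixes X :: "'a set"
  assumes MA: MA_sigma_centered and X: "countable X" and I: "is_ideal_on X I"
  shows "\<exists>\<A>. almost_disjoint_family \<A> \<and> uncountable \<A> \<and>
    (\<forall>m. unboring_witness I m \<longrightarrow> captures I m \<A>)"
proof -
  obtain enum :: "real \<Rightarrow> 'a \<rightharpoonup> nat" where enum: "{m. dom m \<subseteq> X} \<subseteq> range enum"
    using partial_maps_to_nat_lepoll_reals[OF X] unfolding lepoll_iff by blast
  have "\<exists>\<A>. almost_disjoint_family \<A> \<and> uncountable \<A> \<and>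
      (\<forall>i. unboring_witness I (enum i) \<longrightarrow> captures I (enum i) \<A>)"
  proof (rule almost_disjoint_family_by_recursion)
    show "\<exists>B. almost_disjoint_from \<A> B \<and>
        (unboring_witness I (enum i) \<longrightarrow> captures I (enum i) (insert B \<A>))"
      if "almost_disjoint_family \<A>" "\<A> \<prec> (UNIV :: real set)" for i \<A>
      using MA that X I by (rule MA_extend_almost_disjoint_family)
  qed (blast intro: captures_mono)
  then obtain \<A> where \<A>: "almost_disjoint_family \<A>" "uncountable \<A>"
    "\<And>i. unboring_witness I (enum i) \<Longrightarrow> captures I (enum i) \<A>"
    by (elim exE conjE) blast
  have "captures I m \<A>" if m: "unboring_witness I m" for m
  proof -
    have "dom m \<subseteq> X" using m by (simp add: unboring_witness_def Union_is_ideal_on[OF I])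
    then obtain i where "m = enum i" using enum by blast
    with m \<A>(3) show ?thesis by simp
  qed
  with \<A>(1,2) show ?thesis by blast
qed

section \<open>Convergence along cofinite subsets\<close>

abbreviation cofinite_on :: "'a set \<Rightarrow> 'a filter" where
  "cofinite_on A \<equiv> inf cofinite (principal A)"

lemma eventually_cofinite_on:
  "eventually P (cofinite_on A) \<longleftrightarrow> finite {x \<in> A. \<not> P x}"
  by (simp add: eventually_inf_principal eventually_cofinite)

lemma cofinite_on_eq_bot_iff: "cofinite_on A = bot \<longleftrightarrow> finite A"
  by (simp add: trivial_limit_def eventually_cofinite_on)

lemma limitin_topology_generated_by:
  "limitin (topology_generated_by \<S>) f l F \<longleftrightarrow>
     l \<in> \<Union>\<S> \<and> (\<forall>U\<in>\<S>. l \<in> U \<longrightarrow> eventually (\<lambda>x. f x \<in> U) F)" (is "?lhs \<longleftrightarrow> ?rhs")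
proof
  assume ?lhs
  then show ?rhs
    unfolding limitin_def topology_generated_by_topspace by (blast intro: topology_generated_by_Basis)
next
  assume subbase: ?rhs
  have "l \<in> U \<longrightarrow> eventually (\<lambda>x. f x \<in> U) F" if "generate_topology_on \<S> U" for U
    using that
  proof induction
    case (UN \<K>)
    show ?case
    proof
      assume "l \<in> \<Union>\<K>"
      then obtain U where "U \<in> \<K>" "eventually (\<lambda>x. f x \<in> U) F" using UN.IH by blast
      then show "eventually (\<lambda>x. f x \<in> \<Union>\<K>) F" by (auto elim: eventually_mono)
    qed
  qed (use subbase in \<open>auto intro: eventually_conj\<close>)
  then show ?lhs
    unfolding limitin_def topology_generated_by_topspace
    using subbase by (blast dest: openin_topology_generated_by)
qed

lemma limitin_cofinite_on_finite_to_one: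
  assumes lim: "limitin T h l (cofinite_on N)"
    and x: "x ` D \<subseteq> insert l (h ` N)" "\<And>p. finite (x -` {p} \<inter> D)"
  shows "limitin T x l (cofinite_on D)"
  unfolding limitin_def eventually_cofinite_on
proof (intro conjI allI impI)
  show "l \<in> topspace T" using lim by (rule limitin_topspace)
  fix U assume U: "openin T U \<and> l \<in> U"
  then have "finite {i \<in> N. h i \<notin> U}" using limitinD[OF lim] by (simp add: eventually_cofinite_on)
  then have "finite (x -` h ` {i \<in> N. h i \<notin> U} \<inter> D)"
    by (rule finite_finite_vimage_IntI[OF finite_imageI]) (rule x(2))
  moreover have "{n \<in> D. x n \<notin> U} \<subseteq> x -` h ` {i \<in> N. h i \<notin> U} \<inter> D"
    using x(1) U by auto
  ultimately show "finite {n \<in> D. x n \<notin> U}" by (rule rev_finite_subset)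
qed

lemma FinBW_iff_limitin:
  "FinBW I T \<longleftrightarrow> Hausdorff_space T \<and>
     (\<forall>x. x \<in> \<Union>I \<rightarrow> topspace T \<longrightarrow>
        (\<exists>A l. A \<subseteq> \<Union>I \<and> A \<notin> I \<and> limitin T x l (cofinite_on A)))"
  unfolding FinBW_def limitin_def eventually_cofinite_on Pi_def by blast

lemma Hausdorff_space_clopen_separation:
  assumes "\<And>p q. p \<in> topspace T \<Longrightarrow> q \<in> topspace T \<Longrightarrow> p \<noteq> q \<Longrightarrow>
    \<exists>U. openin T U \<and> closedin T U \<and> (p \<in> U \<longleftrightarrow> q \<notin> U)"
  shows "Hausdorff_space T"
  unfolding Hausdorff_space_def
proof (intro allI impI)
  fix p q assume pq: "p \<in> topspace T \<and> q \<in> topspace T \<and> p \<noteq> q"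
  then obtain U where U: "openin T U" "closedin T U" "p \<in> U \<longleftrightarrow> q \<notin> U" using assms by blast
  then have "openin T (topspace T - U)" by blast
  moreover have "disjnt U (topspace T - U)" "disjnt (topspace T - U) U" by (auto simp: disjnt_iff)
  ultimately show "\<exists>U V. openin T U \<and> openin T V \<and> p \<in> U \<and> q \<in> V \<and> disjnt U V"
    using U pq by (cases "p \<in> U") blast+
qed

section \<open>Mrowka spaces\<close>

lemma topspace_Mrowka: "topspace (Mrowka \<A>) = range MNat \<union> MSet ` \<A> \<union> {MInf}"
proof
  show "topspace (Mrowka \<A>) \<subseteq> range MNat \<union> MSet ` \<A> \<union> {MInf}"
    unfolding Mrowka_def topology_generated_by_topspace mrowka_basis_def by auto
  have "{MNat n} \<in> mrowka_basis \<A>" for n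
    unfolding mrowka_basis_def by blast
  moreover have "insert (MSet A) (MNat ` (A - {})) \<in> mrowka_basis \<A>" if "A \<in> \<A>" for A
    unfolding mrowka_basis_def using that by blast
  moreover have "insert MInf (MSet ` (\<A> - {}) \<union> MNat ` (UNIV - ({} \<union> \<Union>{}))) \<in> mrowka_basis \<A>"
    unfolding mrowka_basis_def by blast
  ultimately show "range MNat \<union> MSet ` \<A> \<union> {MInf} \<subseteq> topspace (Mrowka \<A>)"
    unfolding Mrowka_def topology_generated_by_topspace by blast
qed

lemma openin_Mrowka_MNat: "openin (Mrowka \<A>) {MNat n}"
  unfolding Mrowka_def by (rule topology_generated_by_Basis) (auto simp: mrowka_basis_def)

lemma openin_Mrowka_MSet:
  "A \<in> \<A> \<Longrightarrow> finite F \<Longrightarrow> openin (Mrowka \<A>) (insert (MSet A) (MNat ` (A - F)))"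
  unfolding Mrowka_def by (rule topology_generated_by_Basis) (auto simp: mrowka_basis_def)

lemma openin_Mrowka_MInf:
  "finite F \<Longrightarrow> finite G \<Longrightarrow> G \<subseteq> \<A> \<Longrightarrow>
    openin (Mrowka \<A>) (insert MInf (MSet ` (\<A> - G) \<union> MNat ` (UNIV - (F \<union> \<Union>G))))"
  unfolding Mrowka_def by (rule topology_generated_by_Basis) (unfold mrowka_basis_def, blast)

lemma closedin_Mrowka_MNat: "closedin (Mrowka \<A>) {MNat n}"
proof -
  have "topspace (Mrowka \<A>) - {MNat n} = insert MInf (MSet ` (\<A> - {}) \<union> MNat ` (UNIV - ({n} \<union> \<Union>{})))"
    by (auto simp: topspace_Mrowka)
  then show ?thesis
    using openin_Mrowka_MInf[of "{n}" "{}" \<A>] by (simp add: closedin_def topspace_Mrowka)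
qed

lemma closedin_Mrowka_MSet:
  assumes "A \<in> \<A>"
  shows "closedin (Mrowka \<A>) (insert (MSet A) (MNat ` A))"
proof -
  have "topspace (Mrowka \<A>) - insert (MSet A) (MNat ` A) =
      insert MInf (MSet ` (\<A> - {A}) \<union> MNat ` (UNIV - ({} \<union> \<Union>{A})))"
    by (auto simp: topspace_Mrowka)
  then show ?thesis
    using assms openin_Mrowka_MInf[of "{}" "{A}" \<A>] by (auto simp: closedin_def topspace_Mrowka)
qed

lemma Hausdorff_space_Mrowka: "Hausdorff_space (Mrowka \<A>)"
proof (rule Hausdorff_space_clopen_separation)
  have clopen_MSet: "openin (Mrowka \<A>) (insert (MSet A) (MNat ` A))"
    "closedin (Mrowka \<A>) (insert (MSet A) (MNat ` A))" if "A \<in> \<A>" for A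
    using that openin_Mrowka_MSet[of A \<A> "{}"] closedin_Mrowka_MSet by simp_all
  fix p q assume pq: "p \<in> topspace (Mrowka \<A>)" "q \<in> topspace (Mrowka \<A>)" "p \<noteq> q"
  then consider (MNat) n where "p = MNat n \<or> q = MNat n"
    | (MSet) A where "A \<in> \<A>" "p = MSet A \<or> q = MSet A" "p \<notin> range MNat" "q \<notin> range MNat"
    unfolding topspace_Mrowka by blast
  then show "\<exists>U. openin (Mrowka \<A>) U \<and> closedin (Mrowka \<A>) U \<and> (p \<in> U \<longleftrightarrow> q \<notin> U)"
  proof cases
    case (MNat n)
    with pq(3) show ?thesis
      using openin_Mrowka_MNat closedin_Mrowka_MNat by (intro exI[of _ "{MNat n}"]) auto
  next
    case (MSet A)
    with pq(3) show ?thesis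
      using clopen_MSet[OF MSet(1)] by (intro exI[of _ "insert (MSet A) (MNat ` A)"]) auto
  qed
qed

lemma limitin_Mrowka_MSet:
  assumes \<A>: "almost_disjoint_family \<A>" and A: "A \<in> \<A>"
  shows "limitin (Mrowka \<A>) MNat (MSet A) (cofinite_on A)"
  unfolding Mrowka_def limitin_topology_generated_by eventually_cofinite_on
proof (intro conjI ballI impI)
  show "MSet A \<in> \<Union>(mrowka_basis \<A>)"
    using A topspace_Mrowka[of \<A>] by (simp add: Mrowka_def)
  fix U assume U: "U \<in> mrowka_basis \<A>" "MSet A \<in> U"
  then consider (MSet) F where "U = insert (MSet A) (MNat ` (A - F))" "finite F"
    | (MInf) F G where "U = insert MInf (MSet ` (\<A> - G) \<union> MNat ` (UNIV - (F \<union> \<Union>G)))"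
        "finite F" "finite G" "G \<subseteq> \<A>" "A \<notin> G"
    unfolding mrowka_basis_def by auto
  then show "finite {n \<in> A. MNat n \<notin> U}"
  proof cases
    case (MSet F)
    then show ?thesis by (auto simp: image_iff elim!: rev_finite_subset)
  next
    case (MInf F G)
    then have "finite (F \<union> (A \<inter> \<Union>G))"
      using almost_disjoint_family_finite_Int_Union[OF \<A> A] by blast
    then show ?thesis by (rule rev_finite_subset) (use MInf(1) in auto)
  qed
qed

lemma limitin_Mrowka_MInf: "limitin (Mrowka \<A>) MSet MInf (cofinite_on \<A>)"
  unfolding Mrowka_def limitin_topology_generated_by eventually_cofinite_on
proof (intro conjI ballI impI)
  show "MInf \<in> \<Union>(mrowka_basis \<A>)"
    using topspace_Mrowka[of \<A>] by (simp add: Mrowka_def)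
  fix U assume "U \<in> mrowka_basis \<A>" "MInf \<in> U"
  then obtain F G where "finite G"
    "U = insert MInf (MSet ` (\<A> - G) \<union> MNat ` (UNIV - (F \<union> \<Union>G)))"
    unfolding mrowka_basis_def by auto
  then show "finite {A \<in> \<A>. MSet A \<notin> U}" by (auto elim!: rev_finite_subset)
qed

lemma separable_space_Mrowka:
  assumes \<A>: "almost_disjoint_family \<A>"
  shows "separable_space (Mrowka \<A>)"
proof -
  let ?cl = "Mrowka \<A> closure_of range MNat"
  have "range MNat \<subseteq> ?cl" by (rule closure_of_subset) (auto simp: topspace_Mrowka)
  then have MNat: "MNat n \<in> ?cl" for n by blast
  have MSet: "MSet A \<in> ?cl" if A: "A \<in> \<A>" for A
  proof (rule limitin_closedin[OF limitin_Mrowka_MSet[OF \<A> A] closedin_closure_of])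
    show "\<not> trivial_limit (cofinite_on A)"
      using \<A> A by (simp add: cofinite_on_eq_bot_iff almost_disjoint_family_def)
  qed (simp add: MNat)
  have "MInf \<in> ?cl"
  proof (rule limitin_closedin[OF limitin_Mrowka_MInf closedin_closure_of])
    show "\<not> trivial_limit (cofinite_on \<A>)"
      using \<A> by (simp add: cofinite_on_eq_bot_iff almost_disjoint_family_def)
  qed (simp add: MSet eventually_cofinite_on cong: conj_cong)
  then have "?cl = topspace (Mrowka \<A>)"
    using MNat MSet closure_of_subset_topspace[of "Mrowka \<A>" "range MNat"]
    by (auto simp: topspace_Mrowka)
  then show ?thesis
    unfolding separable_space_def by (intro exI[of _ "range MNat"]) (auto simp: topspace_Mrowka)
qed

lemma uncountable_topspace_Mrowka:
  assumes "uncountable \<A>"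
  shows "uncountable (topspace (Mrowka \<A>))"
proof -
  have "uncountable (MSet ` \<A>)"
    using assms countable_image_inj_on[of MSet \<A>] by (auto simp: inj_on_def)
  then show ?thesis by (simp add: topspace_Mrowka)
qed

section \<open>Strongly unboring ideals and Mrowka spaces\<close>

lemma strongly_unboring_finite_to_one:
  fixes x :: "'a \<Rightarrow> 'b"
  assumes X: "countable X" and I: "is_ideal_on X I" and su: "strongly_unboring I"
    and fibres: "\<And>p. x -` {p} \<inter> X \<in> I"
  obtains C where "C \<subseteq> X" "C \<notin> I" "\<And>p. finite (x -` {p} \<inter> C)"
    "omega_diag_univ C (ideal_restr I C)"
proof -
  note Union_I = Union_is_ideal_on[OF I]
  let ?code = "to_nat_on (x ` X)"
  define f where "f n = (if n \<in> X then ?code (x n) else undefined)" for n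
  have "{n \<in> X. f n = k} \<in> I" for k
  proof (rule is_ideal_on_subset[OF I fibres])
    show "{n \<in> X. f n = k} \<subseteq> x -` {from_nat_into (x ` X) k} \<inter> X"
      using X by (auto simp: f_def)
  qed
  then have "f \<in> D_ideal I" by (simp add: D_ideal_def Union_I f_def)
  then obtain C where C: "C \<subseteq> X" "C \<notin> I" "\<And>k. finite {n \<in> C. f n = k}"
    "omega_diag_univ C (ideal_restr I C)"
    using su unfolding strongly_unboring_def Union_I by blast
  moreover have "finite (x -` {p} \<inter> C)" for p
    by (rule finite_subset[OF _ C(3)[of "?code p"]]) (use C(1) in \<open>auto simp: f_def\<close>)
  ultimately show thesis by (intro that)
qed

lemma ex_finite_to_one_partial_map:
  fixes h :: "nat \<Rightarrow> 'b" and x :: "'a \<Rightarrow> 'b"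
  assumes C: "countable C" and x: "\<And>p. finite (x -` {p} \<inter> C)"
  shows "\<exists>m :: 'a \<rightharpoonup> nat. dom m = C \<and> (\<forall>k. finite (m -` {Some k})) \<and>
    (\<forall>n\<in>C. x n \<in> range h \<longrightarrow> x n = h (the (m n)))"
proof -
  define m where "m n = (if n \<notin> C then None
    else Some (if x n \<in> range h then inv h (x n) else to_nat_on C n))" for n
  have "finite (m -` {Some k})" for k
  proof (rule finite_subset)
    show "m -` {Some k} \<subseteq> (x -` {h k} \<inter> C) \<union> (to_nat_on C -` {k} \<inter> C)"
      by (auto simp: m_def f_inv_into_f split: if_splits)
    show "finite ((x -` {h k} \<inter> C) \<union> (to_nat_on C -` {k} \<inter> C))"
      using C by (intro finite_UnI x finite_vimage_IntI inj_on_to_nat_on) simp_all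
  qed
  moreover have "dom m = C" by (auto simp: m_def dom_def)
  moreover have "x n = h (the (m n))" if "n \<in> C" "x n \<in> range h" for n
    using that by (simp add: m_def f_inv_into_f)
  ultimately show ?thesis by blast
qed

lemma Mrowka_nat_valued_convergent:
  fixes X :: "'a set"
  assumes X: "countable X" and I: "is_ideal_on X I"
    and \<A>: "almost_disjoint_family \<A>" "\<And>m. unboring_witness I m \<Longrightarrow> captures I m \<A>"
    and C: "C \<subseteq> X" "C \<notin> I" "omega_diag_univ C (ideal_restr I C)"
    and x: "\<And>p. finite (x -` {p} \<inter> C)" "{n \<in> C. x n \<notin> range MNat} \<in> I"
  shows "\<exists>D l. D \<subseteq> C \<and> D \<notin> I \<and> limitin (Mrowka \<A>) x l (cofinite_on D)"
proof -
  obtain m :: "'a \<rightharpoonup> nat" where dom: "dom m = C" and fin: "\<And>k. finite (m -` {Some k})"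
    and m: "\<And>n. n \<in> C \<Longrightarrow> x n \<in> range MNat \<Longrightarrow> x n = MNat (the (m n))"
    using ex_finite_to_one_partial_map[OF countable_subset[OF C(1) X] x(1), where h = MNat] by metis
  then have "unboring_witness I m"
    using C by (simp add: unboring_witness_def Union_is_ideal_on[OF I])
  then obtain A where A: "A \<in> \<A>" "m -` Some ` A \<notin> I" using \<A>(2) unfolding captures_def by blast
  define D where "D = m -` Some ` A - {n \<in> C. x n \<notin> range MNat}"
  have D: "D \<subseteq> C" using dom by (auto simp: D_def)
  have "D \<notin> I" unfolding D_def using I A(2) x(2) by (rule is_ideal_on_Diff_notin)
  have "x ` D \<subseteq> insert (MSet A) (MNat ` A)"
  proof (rule image_subsetI)
    fix n assume "n \<in> D"
    then have "the (m n) \<in> A" "x n \<in> range MNat" using D by (auto simp: D_def)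
    with m D \<open>n \<in> D\<close> show "x n \<in> insert (MSet A) (MNat ` A)" by blast
  qed
  moreover have "finite (x -` {p} \<inter> D)" for p by (rule finite_subset[OF _ x(1)[of p]]) (use D in auto)
  ultimately have "limitin (Mrowka \<A>) x (MSet A) (cofinite_on D)"
    by (rule limitin_cofinite_on_finite_to_one[OF limitin_Mrowka_MSet[OF \<A>(1) A(1)]])
  with D \<open>D \<notin> I\<close> show ?thesis by blast
qed

lemma Mrowka_finite_to_one_convergent:
  fixes X :: "'a set"
  assumes X: "countable X" and I: "is_ideal_on X I"
    and \<A>: "almost_disjoint_family \<A>" "\<And>m. unboring_witness I m \<Longrightarrow> captures I m \<A>"
    and C: "C \<subseteq> X" "C \<notin> I" "omega_diag_univ C (ideal_restr I C)"
    and x: "x \<in> C \<rightarrow> topspace (Mrowka \<A>)" "\<And>p. finite (x -` {p} \<inter> C)"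
  shows "\<exists>D l. D \<subseteq> C \<and> D \<notin> I \<and> limitin (Mrowka \<A>) x l (cofinite_on D)"
proof (cases "{n \<in> C. x n \<notin> range MNat} \<in> I")
  case True
  with X I \<A> C x(2) show ?thesis by (rule Mrowka_nat_valued_convergent)
next
  case False
  let ?E = "{n \<in> C. x n \<notin> range MNat}"
  have "x ` ?E \<subseteq> insert MInf (MSet ` \<A>)"
    using x(1) by (auto simp: topspace_Mrowka)
  moreover have "finite (x -` {p} \<inter> ?E)" for p by (rule finite_subset[OF _ x(2)[of p]]) auto
  ultimately have "limitin (Mrowka \<A>) x MInf (cofinite_on ?E)"
    by (rule limitin_cofinite_on_finite_to_one[OF limitin_Mrowka_MInf])
  with False show ?thesis by (intro exI[of _ ?E] exI[of _ MInf] conjI) auto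
qed

lemma FinBW_Mrowka:
  assumes X: "countable X" and I: "is_ideal_on X I" and su: "strongly_unboring I"
    and \<A>: "almost_disjoint_family \<A>" "\<And>m. unboring_witness I m \<Longrightarrow> captures I m \<A>"
  shows "FinBW I (Mrowka \<A>)"
  unfolding FinBW_iff_limitin Union_is_ideal_on[OF I]
proof (intro conjI allI impI)
  show "Hausdorff_space (Mrowka \<A>)" by (rule Hausdorff_space_Mrowka)
  fix x assume x: "x \<in> X \<rightarrow> topspace (Mrowka \<A>)"
  show "\<exists>A l. A \<subseteq> X \<and> A \<notin> I \<and> limitin (Mrowka \<A>) x l (cofinite_on A)"
  proof (cases "\<exists>p. x -` {p} \<inter> X \<notin> I")
    case True
    then obtain p where p: "x -` {p} \<inter> X \<notin> I" by blast
    then have "x -` {p} \<inter> X \<noteq> {}" using is_ideal_on_finite[OF I, of "{}"] by auto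
    then have "p \<in> topspace (Mrowka \<A>)" using x by blast
    then have "limitin (Mrowka \<A>) x p (cofinite_on (x -` {p} \<inter> X))"
      by (rule limitin_eventually) (simp add: eventually_inf_principal)
    with p show ?thesis by (intro exI conjI) auto
  next
    case False
    then have fibres: "x -` {p} \<inter> X \<in> I" for p by simp
    obtain C where C: "C \<subseteq> X" "C \<notin> I" "\<And>p. finite (x -` {p} \<inter> C)"
      "omega_diag_univ C (ideal_restr I C)"
      using strongly_unboring_finite_to_one[OF X I su fibres] by blast
    have "x \<in> C \<rightarrow> topspace (Mrowka \<A>)" using x C(1) by blast
    with X I \<A> C(1,2,4) have "\<exists>D l. D \<subseteq> C \<and> D \<notin> I \<and> limitin (Mrowka \<A>) x l (cofinite_on D)"
      using C(3) by (rule Mrowka_finite_to_one_convergent)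
    with C(1) show ?thesis by (meson order_trans)
  qed
qed

theorem theorem5p6:
  fixes X :: "'a set" and I :: "'a set set"
  assumes MA: MA_sigma_centered
    and X: "countable X" "infinite X"
    and I: "is_ideal_on X I"
    and su: "strongly_unboring I"
  shows "\<exists>\<A>. almost_disjoint_family \<A> \<and> uncountable (topspace (Mrowka \<A>)) \<and>
             separable_space (Mrowka \<A>) \<and> FinBW I (Mrowka \<A>)"
proof -
  obtain \<A> where \<A>: "almost_disjoint_family \<A>" "uncountable \<A>"
    "\<And>m. unboring_witness I m \<Longrightarrow> captures I m \<A>"
    using MA_uncountable_family_capturing_witnesses[OF MA X(1) I] by (elim exE conjE) blast
  have "uncountable (topspace (Mrowka \<A>))"
    using \<A>(2) by (rule uncountable_topspace_Mrowka)
  moreover have "separable_space (Mrowka \<A>)"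
    using \<A>(1) by (rule separable_space_Mrowka)
  moreover have "FinBW I (Mrowka \<A>)"
    using X(1) I su \<A>(1,3) by (rule FinBW_Mrowka)
  ultimately show ?thesis using \<A>(1) by blast
qed

end
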